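(* For every integer $k \geq 3$, $r_+(H_k) \geq \frac{1}{16}|V(H_k)|$; that is, the $\mathrm{LS}_+$-rank of the fractional stable set polytope of $H_k$ is at least $\frac{1}{16}|V(H_k)|$.
   Context: Write $[k] = \{1,\dots,k\}$. For an integer $k\ge 2$, $H_k$ is the simple undirected graph with vertex set $V(H_k)=\{i_p : i\in[k],\ p\in\{0,1,2\}\}$ (so $|V(H_k)|=3k$) and edges: $\{i_0,i_1\}$ and $\{i_1,i_2\}$ for every $i\in[k]$; and $\{i_0,j_2\}$ for all $i,j\in[k]$ with $i\ne j$. For a finite simple undirected graph $G$, $\mathrm{FRAC}(G)=\{x\in[0,1]^{V(G)} : x_i+x_j\le 1 \text{ for all } \{i,j\}\in E(G)\}$ and $\mathrm{STAB}(G)=\mathrm{conv}(\mathrm{FRAC}(G)\cap\{0,1\}^{V(G)})$. For a convex set $P\subseteq[0,1]^n$, let $\mathrm{cone}(P)=\left\{\begin{bmatrix}\lambda\\ \lambda x\end{bmatrix} : \lambda\ge 0,\ x\in P\right\}\subseteq\mathbb{R}^{n+1}$, with the new coordinate indexed by $0$. Let $\widehat{\mathrm{LS}}_+(P)$ be the set of symmetric positive semidefinite real $(n+1)\times(n+1)$ matrices $Y$ (rows and columns indexed by $0,1,\dots,n$) such that $Ye_0=\mathrm{diag}(Y)$ (the vector of diagonal entries) and $Ye_i,\ Y(e_0-e_i)\in\mathrm{cone}(P)$ for all $i\in[n]$, where $e_i$ is the $i$-th unit vector. Let $\mathrm{LS}_+(P)=\left\{x\in\mathbb{R}^n : \exists\,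 Y\in\widehat{\mathrm{LS}}_+(P),\ Ye_0=\begin{bmatrix}1\\ x\end{bmatrix}\right\}$, $\mathrm{LS}_+^0(P)=P$ and $\mathrm{LS}_+^{p}(P)=\mathrm{LS}_+(\mathrm{LS}_+^{p-1}(P))$ for $p\ge1$. The $\mathrm{LS}_+$-rank $r_+(G)$ of a graph $G$ (also called the $\mathrm{LS}_+$-rank of $\mathrm{FRAC}(G)$) is the least integer $p\ge0$ with $\mathrm{LS}_+^p(\mathrm{FRAC}(G))=\mathrm{STAB}(G)$. *)

theory Defs
  imports "HOL-Analysis.Analysis" "HOL-Library.Function_Algebras"
begin

text \<open>
  The dimension varies with the graph, so vectors and matrices are functions on an index type
  together with an explicit finite index set. Making \<^typ>\<open>'a \<Rightarrow> real\<close> a real vector space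
  (with pointwise operations) gives access to the library's convex hull.
\<close>

instantiation "fun" :: (type, real_vector) real_vector
begin

definition scaleR_fun :: "real \<Rightarrow> ('a \<Rightarrow> 'b) \<Rightarrow> 'a \<Rightarrow> 'b"
  where "scaleR_fun r f = (\<lambda>x. r *\<^sub>R f x)"

instance
  by standard (simp_all add: scaleR_fun_def fun_eq_iff scaleR_add_right scaleR_add_left)

end

lemma scaleR_fun_apply [simp]: "(r *\<^sub>R f) x = r *\<^sub>R f x"
  by (simp add: scaleR_fun_def)

text \<open>
  \<open>vectors I\<close> is the space of real vectors indexed by \<open>I\<close>. Requiring the value 0 outside \<open>I\<close>
  makes equality of such functions the same as equality of vectors.
\<close>

definition vectors :: "'a set \<Rightarrow> ('a \<Rightarrow> real) set"
  where "vectors I = {x. \<forall>i. i \<notin> I \<longrightarrow> x i = 0}"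

definition matrices :: "'a set \<Rightarrow> ('a \<Rightarrow> 'a \<Rightarrow> real) set"
  where "matrices I = {Y. \<forall>i j. i \<notin> I \<or> j \<notin> I \<longrightarrow> Y i j = 0}"

definition sym_psd :: "'a set \<Rightarrow> ('a \<Rightarrow> 'a \<Rightarrow> real) \<Rightarrow> bool"
  where "sym_psd I Y \<longleftrightarrow>
    (\<forall>i\<in>I. \<forall>j\<in>I. Y i j = Y j i) \<and>
    (\<forall>z \<in> vectors I. 0 \<le> (\<Sum>i\<in>I. \<Sum>j\<in>I. z i * Y i j * z j))"

definition col :: "('a \<Rightarrow> 'a \<Rightarrow> real) \<Rightarrow> 'a \<Rightarrow> 'a \<Rightarrow> real"
  where "col Y j = (\<lambda>i. Y i j)"

definition diag :: "('a \<Rightarrow> 'a \<Rightarrow> real) \<Rightarrow> 'a \<Rightarrow> real"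
  where "diag Y = (\<lambda>i. Y i i)"

text \<open>
  Finite simple graphs are given by a vertex set \<open>V\<close> and a set \<open>E\<close> of two-element subsets of \<open>V\<close>.
\<close>

definition FRAC :: "'v set \<Rightarrow> 'v set set \<Rightarrow> ('v \<Rightarrow> real) set"
  where "FRAC V E = {x \<in> vectors V.
    (\<forall>v\<in>V. 0 \<le> x v \<and> x v \<le> 1) \<and> (\<forall>u v. {u, v} \<in> E \<longrightarrow> x u + x v \<le> 1)}"

definition STAB :: "'v set \<Rightarrow> 'v set set \<Rightarrow> ('v \<Rightarrow> real) set"
  where "STAB V E = convex hull {x \<in> FRAC V E. \<forall>v\<in>V. x v \<in> {0, 1}}"

text \<open>
  In the homogenized space, \<^const>\<open>None\<close> is the new coordinate (usually indexed by 0) and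
  \<^term>\<open>Some v\<close> is the coordinate of \<open>v\<close>.
\<close>

definition homog_indices :: "'v set \<Rightarrow> 'v option set"
  where "homog_indices V = insert None (Some ` V)"

definition homog :: "real \<Rightarrow> ('v \<Rightarrow> real) \<Rightarrow> 'v option \<Rightarrow> real"
  where "homog t x = case_option t x"

definition cone_of :: "('v \<Rightarrow> real) set \<Rightarrow> ('v option \<Rightarrow> real) set"
  where "cone_of P = {homog t (t *\<^sub>R x) | t x. 0 \<le> t \<and> x \<in> P}"

text \<open>\<^term>\<open>col Y None - col Y (Some v)\<close> is the vector \<open>Y (e\<^sub>0 - e\<^sub>v)\<close>.\<close>

definition LS_plus_lift ::
    "'v set \<Rightarrow> ('v \<Rightarrow> real) set \<Rightarrow> ('v option \<Rightarrow> 'v option \<Rightarrow> real) set"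
  where "LS_plus_lift V P = {Y \<in> matrices (homog_indices V).
    sym_psd (homog_indices V) Y \<and>
    col Y None = diag Y \<and>
    (\<forall>v\<in>V. col Y (Some v) \<in> cone_of P \<and> col Y None - col Y (Some v) \<in> cone_of P)}"

definition LS_plus :: "'v set \<Rightarrow> ('v \<Rightarrow> real) set \<Rightarrow> ('v \<Rightarrow> real) set"
  where "LS_plus V P = {x \<in> vectors V. \<exists>Y \<in> LS_plus_lift V P. col Y None = homog 1 x}"

definition LS_plus_rank :: "'v set \<Rightarrow> 'v set set \<Rightarrow> nat"
  where "LS_plus_rank V E = (LEAST p. (LS_plus V ^^ p) (FRAC V E) = STAB V E)"

text \<open>The vertex \<open>i\<^sub>p\<close> is the pair \<open>(i, p)\<close>.\<close>

definition H_verts :: "nat \<Rightarrow> (nat \<times> nat) set"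
  where "H_verts k = {1..k} \<times> {0, 1, 2}"

definition H_edges :: "nat \<Rightarrow> (nat \<times> nat) set set"
  where "H_edges k =
    {{(i, 0), (i, 1)} | i. i \<in> {1..k}} \<union>
    {{(i, 1), (i, 2)} | i. i \<in> {1..k}} \<union>
    {{(i, 0), (j, 2)} | i j. i \<in> {1..k} \<and> j \<in> {1..k} \<and> i \<noteq> j}"

lemma card_H_verts: "card (H_verts k) = 3 * k"
  by (simp add: H_verts_def card_cartesian_product)

lemma H_simple_graph: "finite (H_verts k)" "e \<in> H_edges k \<Longrightarrow> e \<subseteq> H_verts k \<and> card e = 2"
  by (auto simp: H_verts_def H_edges_def card_insert_if)

end

theory Submission
  imports Defs
begin

text \<open>
  The rank is a least number of rounds, so two things have to be shown: that the iteration
  reaches the stable set polytope at all, and that it has not reached it after fewer than \<open>3 k /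
  16\<close> rounds. The first is the classical argument that one application of \<open>LS\<^sub>+\<close> writes each
  point as a convex combination of a point with \<open>x\<^sub>v = 0\<close> and a point with \<open>x\<^sub>v = 1\<close>, so that
  treating the vertices one after the other gives \<open>STAB\<close> (\<open>LS_plus_funpow_card\<close>).

  For the second, one follows points that are invariant under the automorphisms of \<open>H\<^sub>k\<close>: all
  \<open>i\<^sub>0\<close> and \<open>i\<^sub>2\<close> get the value \<open>a\<close>, all \<open>i\<^sub>1\<close> the value \<open>b\<close>. In the \<open>(a, b)\<close>-plane the
  invariant points of \<open>STAB\<close> have the vertex \<open>(1/k, (k-1)/k)\<close>, the average of the stable sets
  \<open>{l\<^sub>0, l\<^sub>2} \<union> {j\<^sub>1 | j \<noteq> l}\<close>, and the edge leaving it towards larger \<open>a\<close> has slope \<open>- 2 (k-1)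
  / (k-2)\<close> (\<open>STAB_H_valid\<close>). For \<open>FRAC\<close> the edge through the same point has slope only \<open>-1\<close>. The
  proof measures how fast \<open>LS\<^sub>+\<close> can rotate this edge. After \<open>p\<close> rounds the relaxation still
  contains points in the direction of slope \<open>- (1 + 6 p / (k - 1 + p))\<close> from the vertex
  (\<open>eventually_sym_vec_mem_LS_plus_funpow\<close>); if \<open>5 p < k\<close>, this slope is at least \<open>-2\<close>, flatter
  than the edge of \<open>STAB\<close>. For \<open>p < 3 k / 16\<close> this is the case.

  The induction on \<open>p\<close> works because \<open>H\<^sub>k\<close> reproduces itself: fixing \<open>x\<close> to 1 at \<open>l\<^sub>1\<close> forces
  the values 0 at \<open>l\<^sub>0\<close> and \<open>l\<^sub>2\<close>, and what remains is \<open>H\<close> on the index set without \<open>l\<close>. The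
  round therefore starts from invariant points on \<open>k - 1\<close> indices in round \<open>p - 1\<close>. To stay
  inside one graph, the points carry a set \<open>S\<close> of indices that are still free; for \<open>i \<notin> S\<close> the
  triple \<open>(i\<^sub>0, i\<^sub>1, i\<^sub>2)\<close> has the value \<open>(0, 1, 0)\<close>. The certificate of a round is an explicit
  invariant matrix (\<open>sym_vec_mem_LS_plus\<close>). Its columns and their complements decompose into
  such points for \<open>S - {l}\<close> and three kinds of stable sets, and its positive semidefiniteness
  reduces to one binary quadratic form (\<open>sym_psd_H_lift\<close>). The critical conditions hold with
  equality at the vertex, so at a small distance \<open>\<delta>\<close> from it only their first order parts
  matter, which are inequalities between the old and the new slope
  (\<open>eventually_sym_vec_mem_LS_plus\<close>), and the slopes above satisfy them (\<open>slope_step\<close>).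
\<close>

section \<open>Cones over convex sets\<close>

lemma cone_of_iff:
  "h \<in> cone_of P \<longleftrightarrow> 0 \<le> h None \<and> (\<exists>x\<in>P. \<forall>v. h (Some v) = h None * x v)"
proof
  assume "h \<in> cone_of P"
  then show "0 \<le> h None \<and> (\<exists>x\<in>P. \<forall>v. h (Some v) = h None * x v)"
    by (auto simp: cone_of_def homog_def)
next
  assume "0 \<le> h None \<and> (\<exists>x\<in>P. \<forall>v. h (Some v) = h None * x v)"
  then obtain x where x: "0 \<le> h None" "x \<in> P" "\<forall>v. h (Some v) = h None * x v"
    by blast
  have "h = homog (h None) (h None *\<^sub>R x)"
    using x(3) by (auto simp: fun_eq_iff homog_def split: option.split)
  then show "h \<in> cone_of P"
    unfolding cone_of_def using x by blast
qed

lemma cone_of_homog_1: "x \<in> P \<Longrightarrow> homog 1 x \<in> cone_of P"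
  by (auto simp: cone_of_iff homog_def)

lemma cone_of_zero: "P \<noteq> {} \<Longrightarrow> 0 \<in> cone_of P"
  by (auto simp: cone_of_iff)

lemma cone_of_scale: "0 \<le> r \<Longrightarrow> h \<in> cone_of P \<Longrightarrow> r *\<^sub>R h \<in> cone_of P"
  by (auto simp: cone_of_iff)

lemma cone_of_nonempty: "h \<in> cone_of P \<Longrightarrow> P \<noteq> {}"
  by (auto simp: cone_of_iff)

lemma cone_of_add:
  assumes "convex P" "g \<in> cone_of P" "h \<in> cone_of P"
  shows "g + h \<in> cone_of P"
proof -
  obtain x where x: "0 \<le> g None" "x \<in> P" "\<forall>v. g (Some v) = g None * x v"
    using assms(2) by (auto simp: cone_of_iff)
  obtain y where y: "0 \<le> h None" "y \<in> P" "\<forall>v. h (Some v) = h None * y v"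
    using assms(3) by (auto simp: cone_of_iff)
  define t where "t = g None + h None"
  show ?thesis
  proof (cases "t = 0")
    case True
    then have "g None = 0" "h None = 0" using x(1) y(1) by (auto simp: t_def)
    then show ?thesis using x y by (auto simp: cone_of_iff)
  next
    case False
    then have t: "t > 0" using x(1) y(1) by (simp add: t_def)
    have "(g None / t) *\<^sub>R x + (h None / t) *\<^sub>R y \<in> P"
      using assms(1) x y t by (intro convexD) (auto simp: t_def add_divide_distrib[symmetric])
    moreover have "(g + h) None = t" by (simp add: t_def)
    moreover have "\<forall>v. (g + h) (Some v) = t * ((g None / t) *\<^sub>R x + (h None / t) *\<^sub>R y) v"
      using x(3) y(3) t by (simp add: distrib_left)
    ultimately show ?thesis using t unfolding cone_of_iff by (metis less_imp_le)
  qed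
qed

section \<open>Positive semidefinite matrices\<close>

lemma sym_psd_rank_one: "sym_psd I (\<lambda>i j. g i * g j)"
proof -
  have "(\<Sum>i\<in>I. \<Sum>j\<in>I. z i * (g i * g j) * z j) = (\<Sum>i\<in>I. z i * g i)\<^sup>2" for z :: "'a \<Rightarrow> real"
    by (simp add: power2_eq_square sum_product mult_ac)
  then show ?thesis by (simp add: sym_psd_def)
qed

lemma sym_psd_add:
  assumes "sym_psd I X" "sym_psd I Y"
  shows "sym_psd I (\<lambda>i j. X i j + Y i j)"
  using assms by (auto simp: sym_psd_def algebra_simps sum.distrib intro: add_nonneg_nonneg)

lemma sym_psd_scale:
  assumes "0 \<le> r" "sym_psd I X"
  shows "sym_psd I (\<lambda>i j. r * X i j)"
proof -
  have "(\<Sum>i\<in>I. \<Sum>j\<in>I. z i * (r * X i j) * z j) = r * (\<Sum>i\<in>I. \<Sum>j\<in>I. z i * X i j * z j)" for z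
    by (simp add: sum_distrib_left mult_ac)
  then show ?thesis using assms by (auto simp: sym_psd_def)
qed

lemma sym_psd_sum:
  assumes "\<And>l. l \<in> L \<Longrightarrow> sym_psd I (X l)"
  shows "sym_psd I (\<lambda>i j. \<Sum>l\<in>L. X l i j)"
  using assms
proof (induction L rule: infinite_finite_induct)
  case (insert l L)
  then show ?case by (simp add: sym_psd_add)
qed (auto simp: sym_psd_def)

text \<open>
  Completing the square: a positive semidefinite form in two variables stays positive
  semidefinite when the variables are replaced by the linear functionals with coefficients \<open>u\<close>
  and \<open>w\<close>.
\<close>

lemma sym_psd_binary_form:
  fixes u w :: "'a \<Rightarrow> real"
  assumes "0 < \<alpha>" "\<beta>\<^sup>2 \<le> \<alpha> * \<gamma>"
  shows "sym_psd I (\<lambda>i j. \<alpha> * (u i * u j) + \<beta> * (u i * w j + w i * u j) + \<gamma> * (w i * w j))"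
proof -
  define v where "v = (\<lambda>i. u i + \<beta> / \<alpha> * w i)"
  have "0 \<le> \<gamma> - \<beta>\<^sup>2 / \<alpha>" using assms by (simp add: field_simps)
  then have "sym_psd I (\<lambda>i j. \<alpha> * (v i * v j) + (\<gamma> - \<beta>\<^sup>2 / \<alpha>) * (w i * w j))"
    using assms by (intro sym_psd_add sym_psd_scale sym_psd_rank_one) auto
  also have "(\<lambda>i j. \<alpha> * (v i * v j) + (\<gamma> - \<beta>\<^sup>2 / \<alpha>) * (w i * w j))
      = (\<lambda>i j. \<alpha> * (u i * u j) + \<beta> * (u i * w j + w i * u j) + \<gamma> * (w i * w j))"
    using assms(1) by (auto simp: v_def fun_eq_iff field_simps power2_eq_square)
  finally show ?thesis .
qed

section \<open>Properties preserved by the operator\<close>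

lemma col_apply [simp]: "col Y j i = Y i j"
  by (simp add: col_def)

lemma LS_plus_lift_col_None_mem_cone:
  assumes "convex P" "Y \<in> LS_plus_lift V P" "v \<in> V"
  shows "col Y None \<in> cone_of P"
proof -
  have "col Y (Some v) + (col Y None - col Y (Some v)) \<in> cone_of P"
    using assms by (intro cone_of_add) (auto simp: LS_plus_lift_def)
  then show ?thesis by simp
qed

lemma convex_LS_plus:
  assumes "convex P"
  shows "convex (LS_plus V P)"
proof (rule convexI)
  fix x y and r s :: real
  assume "x \<in> LS_plus V P" "y \<in> LS_plus V P" and rs: "0 \<le> r" "0 \<le> s" "r + s = 1"
  then obtain X Y where x: "x \<in> vectors V" "X \<in> LS_plus_lift V P" "col X None = homog 1 x"
    and y: "y \<in> vectors V" "Y \<in> LS_plus_lift V P" "col Y None = homog 1 y"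
    by (auto simp: LS_plus_def)
  define Z where "Z = (\<lambda>i j. r * X i j + s * Y i j)"
  have colZ: "col Z j = r *\<^sub>R col X j + s *\<^sub>R col Y j" for j
    by (simp add: Z_def col_def fun_eq_iff)
  have "Z \<in> matrices (homog_indices V)"
    using x(2) y(2) by (auto simp: Z_def LS_plus_lift_def matrices_def)
  moreover have "sym_psd (homog_indices V) Z"
    unfolding Z_def using x(2) y(2) rs
    by (intro sym_psd_add sym_psd_scale) (auto simp: LS_plus_lift_def)
  moreover have "col Z None = diag Z"
    using x(2) y(2) by (simp add: Z_def LS_plus_lift_def diag_def col_def fun_eq_iff)
  moreover have "col Z (Some v) \<in> cone_of P \<and> col Z None - col Z (Some v) \<in> cone_of P"
    if "v \<in> V" for v
  proof -
    have "col Z None - col Z (Some v)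
        = r *\<^sub>R (col X None - col X (Some v)) + s *\<^sub>R (col Y None - col Y (Some v))"
      by (simp add: colZ scaleR_diff_right)
    then show ?thesis using that x(2) y(2) rs assms
      by (auto simp: colZ LS_plus_lift_def intro!: cone_of_add cone_of_scale)
  qed
  ultimately have "Z \<in> LS_plus_lift V P"
    by (auto simp: LS_plus_lift_def)
  moreover have "r *\<^sub>R x + s *\<^sub>R y \<in> vectors V"
    using x(1) y(1) by (auto simp: vectors_def)
  moreover have "col Z None = homog 1 (r *\<^sub>R x + s *\<^sub>R y)"
    using x(3) y(3) rs by (auto simp: colZ homog_def fun_eq_iff split: option.split)
  ultimately show "r *\<^sub>R x + s *\<^sub>R y \<in> LS_plus V P"
    by (auto simp: LS_plus_def)
qed

text \<open>
  Closure under setting a single coordinate to 0 passes through the operator by deleting a row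
  and a column of the lift. For convex sets of nonnegative vectors it is the same as closure
  under decreasing coordinates, which is what lets a vector of a cone be certified by any larger
  one.
\<close>

definition zeroing_closed :: "('v \<Rightarrow> real) set \<Rightarrow> bool"
  where "zeroing_closed P \<longleftrightarrow> (\<forall>x\<in>P. \<forall>v. x(v := 0) \<in> P)"

lemma cone_of_zeroing:
  assumes "zeroing_closed P" "h \<in> cone_of P"
  shows "h(Some v := 0) \<in> cone_of P"
proof -
  obtain x where x: "0 \<le> h None" "x \<in> P" "\<forall>v. h (Some v) = h None * x v"
    using assms(2) by (auto simp: cone_of_iff)
  have "x(v := 0) \<in> P" using assms(1) x(2) by (auto simp: zeroing_closed_def)
  then show ?thesis using x by (auto simp: cone_of_iff intro!: bexI[of _ "x(v := 0)"])
qed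

lemma zeroing_closed_LS_plus:
  assumes "convex P" "zeroing_closed P"
  shows "zeroing_closed (LS_plus V P)"
  unfolding zeroing_closed_def
proof (intro ballI allI)
  fix x v
  assume x: "x \<in> LS_plus V P"
  show "x(v := 0) \<in> LS_plus V P"
  proof (cases "v \<in> V")
    case False
    then have "x(v := 0) = x" using x by (auto simp: LS_plus_def vectors_def)
    then show ?thesis using x by simp
  next
    case True
    obtain Y where Y: "Y \<in> LS_plus_lift V P" "col Y None = homog 1 x"
      using x by (auto simp: LS_plus_def)
    define Z where "Z = (\<lambda>i j. if i = Some v \<or> j = Some v then 0 else Y i j)"
    have colZ: "col Z j = (if j = Some v then 0 else (col Y j)(Some v := 0))" for j
      by (auto simp: Z_def col_def fun_eq_iff)
    have "Z \<in> matrices (homog_indices V)"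
      using Y(1) by (auto simp: Z_def LS_plus_lift_def matrices_def)
    moreover have "sym_psd (homog_indices V) Z"
      unfolding sym_psd_def
    proof (intro conjI ballI)
      fix z :: "'a option \<Rightarrow> real"
      assume z: "z \<in> vectors (homog_indices V)"
      define z' where "z' = z(Some v := 0)"
      have "z' \<in> vectors (homog_indices V)" using z by (auto simp: z'_def vectors_def)
      then have "0 \<le> (\<Sum>i\<in>homog_indices V. \<Sum>j\<in>homog_indices V. z' i * Y i j * z' j)"
        using Y(1) by (auto simp: LS_plus_lift_def sym_psd_def)
      also have "\<dots> = (\<Sum>i\<in>homog_indices V. \<Sum>j\<in>homog_indices V. z i * Z i j * z j)"
        by (intro sum.cong refl) (auto simp: z'_def Z_def)
      finally show "0 \<le> (\<Sum>i\<in>homog_indices V. \<Sum>j\<in>homog_indices V. z i * Z i j * z j)" .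
    qed (use Y(1) in \<open>auto simp: Z_def LS_plus_lift_def sym_psd_def\<close>)
    moreover have "col Z None = diag Z"
      using Y(1) by (auto simp: Z_def LS_plus_lift_def diag_def col_def fun_eq_iff)
    moreover have "col Z (Some u) \<in> cone_of P \<and> col Z None - col Z (Some u) \<in> cone_of P"
      if "u \<in> V" for u
    proof (cases "u = v")
      case True
      then show ?thesis
        using cone_of_zeroing[OF assms(2) LS_plus_lift_col_None_mem_cone[OF assms(1) Y(1) \<open>v \<in> V\<close>]]
        by (auto simp: colZ intro!: cone_of_zero dest: cone_of_nonempty)
    next
      case False
      have "col Z None - col Z (Some u) = (col Y None - col Y (Some u))(Some v := 0)"
        using False by (auto simp: colZ fun_eq_iff)
      then show ?thesis using that False Y(1) assms(2)
        by (auto simp: colZ LS_plus_lift_def intro!: cone_of_zeroing)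
    qed
    ultimately have "Z \<in> LS_plus_lift V P" by (auto simp: LS_plus_lift_def)
    moreover have "x(v := 0) \<in> vectors V" using x by (auto simp: LS_plus_def vectors_def)
    moreover have "col Z None = homog 1 (x(v := 0))"
      using Y(2) by (auto simp: colZ homog_def fun_eq_iff split: option.split)
    ultimately show ?thesis by (auto simp: LS_plus_def)
  qed
qed

text \<open>
  Each coordinate in turn is lowered by a convex combination with the vector where it is 0.
\<close>

lemma zeroing_closed_imp_down_closed:
  assumes "finite V" "convex P" "zeroing_closed P" "x \<in> P"
    and "\<And>v. v \<in> V \<Longrightarrow> 0 \<le> y v \<and> y v \<le> x v" "\<And>v. v \<notin> V \<Longrightarrow> y v = x v"
  shows "y \<in> P"
proof -
  have "(\<lambda>v. if v \<in> F then y v else x v) \<in> P" if "finite F" "F \<subseteq> V" for F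
    using that
  proof (induction F rule: finite_induct)
    case empty
    then show ?case using assms(4) by simp
  next
    case (insert v F)
    define z where "z = (\<lambda>v. if v \<in> F then y v else x v)"
    have z: "z \<in> P" using insert by (simp add: z_def)
    then have z0: "z(v := 0) \<in> P" using assms(3) by (simp add: zeroing_closed_def)
    have yv: "0 \<le> y v" "y v \<le> z v" using insert assms(5) by (auto simp: z_def)
    define r where "r = (if z v = 0 then 0 else y v / z v)"
    have r: "0 \<le> r" "r \<le> 1" "r * z v = y v" using yv by (auto simp: r_def divide_simps)
    have "r *\<^sub>R z + (1 - r) *\<^sub>R z(v := 0) \<in> P"
      using r z z0 assms(2) by (intro convexD) auto
    also have "r *\<^sub>R z + (1 - r) *\<^sub>R z(v := 0) = (\<lambda>u. if u \<in> insert v F then y u else x u)"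
      using r(3) insert by (auto simp: fun_eq_iff z_def algebra_simps)
    finally show ?case .
  qed
  from this[OF assms(1)] have "(\<lambda>v. if v \<in> V then y v else x v) \<in> P" by simp
  also have "(\<lambda>v. if v \<in> V then y v else x v) = y" using assms(6) by auto
  finally show ?thesis .
qed

lemma cone_of_down:
  assumes "finite V" "convex P" "zeroing_closed P" "h \<in> cone_of P" "g None = h None"
    and "\<And>v. v \<in> V \<Longrightarrow> 0 \<le> g (Some v) \<and> g (Some v) \<le> h (Some v)"
    and "\<And>v. v \<notin> V \<Longrightarrow> g (Some v) = h (Some v)"
  shows "g \<in> cone_of P"
proof -
  obtain x where x: "0 \<le> h None" "x \<in> P" "\<forall>v. h (Some v) = h None * x v"
    using assms(4) by (auto simp: cone_of_iff)
  show ?thesis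
  proof (cases "h None = 0")
    case True
    then have "g (Some v) = 0" for v using assms(6,7)[of v] x(3) by (cases "v \<in> V") auto
    then show ?thesis using True assms(5) x by (auto simp: cone_of_iff)
  next
    case False
    then have t: "h None > 0" using x(1) by simp
    have "(\<lambda>v. g (Some v) / h None) \<in> P"
      using t x(3) assms(6,7)
      by (intro zeroing_closed_imp_down_closed[OF assms(1-3) x(2)]) (auto simp: field_simps)
    then show ?thesis using t assms(5)
      by (auto simp: cone_of_iff intro!: bexI[of _ "\<lambda>v. g (Some v) / h None"])
  qed
qed

text \<open>
  A 0/1 point certifies itself: the columns of its rank one lift are multiples of the lifted
  point by 0 or 1.
\<close>

lemma zero_one_mem_LS_plus:
  assumes "x \<in> vectors V" "\<And>v. v \<in> V \<Longrightarrow> x v \<in> {0, 1}" "x \<in> P"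
  shows "x \<in> LS_plus V P"
proof -
  have x01: "x v = 0 \<or> x v = 1" for v
    using assms(1) assms(2)[of v] by (cases "v \<in> V") (auto simp: vectors_def)
  define h where "h = homog 1 x"
  have h: "h \<in> cone_of P" using assms(3) by (simp add: h_def cone_of_homog_1)
  have h01: "h i = 0 \<or> h i = 1" for i
    using x01 by (auto simp: h_def homog_def split: option.split)
  have hN: "h None = 1" by (simp add: h_def homog_def)
  define Y where "Y = (\<lambda>i j. h i * h j)"
  have colY: "col Y j = h j *\<^sub>R h" for j by (auto simp: Y_def col_def fun_eq_iff)
  have "Y \<in> matrices (homog_indices V)"
    using assms(1) by (auto simp: Y_def h_def homog_def matrices_def vectors_def homog_indices_def
        image_iff split: option.split)
  moreover have "sym_psd (homog_indices V) Y"
    unfolding Y_def by (rule sym_psd_rank_one)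
  moreover have "col Y None = diag Y"
    unfolding fun_eq_iff
  proof
    fix i show "col Y None i = diag Y i" using h01[of i] hN by (auto simp: Y_def diag_def)
  qed
  moreover have "col Y (Some v) \<in> cone_of P \<and> col Y None - col Y (Some v) \<in> cone_of P" for v
    using h01[of "Some v"] hN h assms(3) by (auto simp: colY intro!: cone_of_zero)
  ultimately have "Y \<in> LS_plus_lift V P" by (auto simp: LS_plus_lift_def)
  moreover have "col Y None = homog 1 x" unfolding h_def[symmetric] by (simp add: colY hN)
  ultimately show ?thesis using assms(1) by (auto simp: LS_plus_def)
qed

section \<open>Iterates of the operator on the fractional polytope\<close>

lemma convex_FRAC: "convex (FRAC V E)"
proof (rule convexI)
  fix x y and r s :: real
  assume xy: "x \<in> FRAC V E" "y \<in> FRAC V E" and rs: "0 \<le> r" "0 \<le> s" "r + s = 1"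
  have bound: "r * p + s * q \<le> 1" if "p \<le> 1" "q \<le> 1" for p q
  proof -
    have "r * p + s * q \<le> r * 1 + s * 1" using that rs by (intro add_mono mult_left_mono)
    then show ?thesis using rs by simp
  qed
  have "r * x u + s * y u + (r * x v + s * y v) \<le> 1" if "{u, v} \<in> E" for u v
    using bound[of "x u + x v" "y u + y v"] xy that by (auto simp: FRAC_def algebra_simps)
  then show "r *\<^sub>R x + s *\<^sub>R y \<in> FRAC V E"
    using xy rs bound by (auto simp: FRAC_def vectors_def)
qed

lemma zeroing_closed_FRAC: "zeroing_closed (FRAC V E)"
  unfolding zeroing_closed_def
proof (intro ballI allI)
  fix x v assume x: "x \<in> FRAC V E"
  have "0 \<le> x u \<and> x u \<le> 1" for u
    using x by (cases "u \<in> V") (auto simp: FRAC_def vectors_def)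
  then have nn: "0 \<le> x u" "x u \<le> 1" for u by auto
  show "x(v := 0) \<in> FRAC V E"
    using x nn by (auto simp: FRAC_def vectors_def)
qed

lemma convex_LS_plus_funpow: "convex ((LS_plus V ^^ p) (FRAC V E))"
  by (induction p) (auto simp: convex_FRAC convex_LS_plus)

lemma zeroing_closed_LS_plus_funpow: "zeroing_closed ((LS_plus V ^^ p) (FRAC V E))"
  by (induction p) (auto simp: zeroing_closed_FRAC zeroing_closed_LS_plus convex_LS_plus_funpow)

lemma zero_one_mem_LS_plus_funpow:
  assumes "x \<in> FRAC V E" "\<And>v. v \<in> V \<Longrightarrow> x v \<in> {0, 1}"
  shows "x \<in> (LS_plus V ^^ p) (FRAC V E)"
proof (induction p)
  case (Suc p)
  have "x \<in> vectors V" using assms(1) by (simp add: FRAC_def)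
  then have "x \<in> LS_plus V ((LS_plus V ^^ p) (FRAC V E))"
    using assms(2) Suc by (intro zero_one_mem_LS_plus) auto
  then show ?case by simp
qed (use assms in simp)

lemma STAB_subset_LS_plus_funpow: "STAB V E \<subseteq> (LS_plus V ^^ p) (FRAC V E)"
  unfolding STAB_def
  by (intro hull_minimal convex_LS_plus_funpow) (auto intro: zero_one_mem_LS_plus_funpow)

text \<open>
  A convex combination attains the maximal value of a linear functional only if all points with
  positive weight do. The proof shows that removing the other points at the maximal level from
  the hull leaves a convex set.
\<close>

lemma convex_hull_face:
  fixes g :: "'a :: real_vector \<Rightarrow> real"
  assumes "linear g" "\<And>x. x \<in> A \<Longrightarrow> g x \<le> c" "y \<in> convex hull A" "g y = c"
  shows "y \<in> convex hull {x \<in> A. g x = c}"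
proof -
  define F where "F = convex hull {x \<in> A. g x = c}"
  have "F \<subseteq> {x. g x = c}"
    unfolding F_def
    using convex_linear_vimage[OF assms(1), of "{c}"] by (intro hull_minimal) (auto simp: vimage_def)
  then have F: "g x = c" if "x \<in> F" for x using that by auto
  have "convex (F \<union> {x. g x < c})"
  proof (rule convexI)
    fix x y and r s :: real
    assume xy: "x \<in> F \<union> {x. g x < c}" "y \<in> F \<union> {x. g x < c}"
      and rs: "0 \<le> r" "0 \<le> s" "r + s = 1"
    have g: "g (r *\<^sub>R x + s *\<^sub>R y) = r * g x + s * g y"
      using assms(1) by (simp add: linear_add linear_scale)
    consider "r = 0" | "s = 0" | "x \<in> F" "y \<in> F"
      | "r \<noteq> 0" "s \<noteq> 0" "\<not> (x \<in> F \<and> y \<in> F)" by blast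
    then show "r *\<^sub>R x + s *\<^sub>R y \<in> F \<union> {x. g x < c}"
    proof cases
      case 3
      have "convex F" by (simp add: F_def)
      then have "r *\<^sub>R x + s *\<^sub>R y \<in> F" using 3 rs by (intro convexD)
      then show ?thesis by simp
    next
      case 4
      then have "0 < r" "0 < s" using rs by auto
      have "g x \<le> c" "g y \<le> c" "g x < c \<or> g y < c" using xy 4 F[of x] F[of y] by auto
      then have "r * g x + s * g y < r * c + s * c"
        using \<open>0 < r\<close> \<open>0 < s\<close>
        by (auto intro: add_less_le_mono add_le_less_mono)
      then show ?thesis using g rs by (simp add: distrib_right[symmetric])
    qed (use xy rs in auto)
  qed
  moreover have "A \<subseteq> F \<union> {x. g x < c}"
  proof
    fix x assume "x \<in> A"
    then show "x \<in> F \<union> {x. g x < c}"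
      using assms(2)[of x] by (cases "g x = c") (auto simp: F_def intro: hull_inc)
  qed
  ultimately have "convex hull A \<subseteq> F \<union> {x. g x < c}" by (intro hull_minimal)
  then show ?thesis using assms(3,4) by (auto simp: F_def)
qed

text \<open>
  The column of \<open>v\<close> and its complement sum to the lifted point. The first belongs to a point
  with \<open>x\<^sub>v = 1\<close> because the diagonal entry equals the entry in the top row, the second to a
  point with \<open>x\<^sub>v = 0\<close>.
\<close>

lemma LS_plus_subset_convex_hull_split:
  assumes "v \<in> V" "A \<subseteq> FRAC V E" "P \<subseteq> convex hull A"
  shows "LS_plus V P \<subseteq> convex hull {x \<in> A. x v \<in> {0, 1}}"
proof
  fix x assume "x \<in> LS_plus V P"
  then obtain Y where Y: "Y \<in> LS_plus_lift V P" "col Y None = homog 1 x"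
    by (auto simp: LS_plus_def)
  define g h where "g = col Y (Some v)" and "h = col Y None - col Y (Some v)"
  have "g \<in> cone_of P" "h \<in> cone_of P" using Y(1) assms(1) by (auto simp: g_def h_def LS_plus_lift_def)
  then obtain y z where y: "0 \<le> g None" "y \<in> P" "\<forall>v. g (Some v) = g None * y v"
    and z: "0 \<le> h None" "z \<in> P" "\<forall>v. h (Some v) = h None * z v"
    by (auto simp: cone_of_iff)
  have diag: "Y (Some v) None = Y (Some v) (Some v)"
    using Y(1) by (auto simp: LS_plus_lift_def diag_def col_def fun_eq_iff)
  have sym: "Y None (Some v) = Y (Some v) None"
  proof -
    have "None \<in> homog_indices V" "Some v \<in> homog_indices V"
      using assms(1) by (auto simp: homog_indices_def)
    then show ?thesis using Y(1) unfolding LS_plus_lift_def sym_psd_def by blast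
  qed
  have gh: "Y i None = g i + h i" for i by (simp add: g_def h_def)
  have x: "x u = g None * y u + h None * z u" for u
    using fun_cong[OF Y(2), of "Some u"] y(3) z(3) gh[of "Some u"] by (simp add: homog_def)
  have sum1: "g None + h None = 1"
    using fun_cong[OF Y(2), of None] gh[of None] by (simp add: homog_def)
  define B where "B = {x \<in> A. x v \<in> {0, 1}}"
  have lin: "linear (\<lambda>x. x v :: real)" by (rule linearI) simp_all
  have yB: "y \<in> convex hull B" if "g None \<noteq> 0"
  proof -
    have "g (Some v) = g None" using diag sym by (simp add: g_def)
    then have "y v = 1" using y(3)[rule_format, of v] that by simp
    then have "y \<in> convex hull {x \<in> A. x v = 1}"
      using y(2) assms lin by (intro convex_hull_face[where g = "\<lambda>x. x v"]) (auto simp: FRAC_def)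
    also have "\<dots> \<subseteq> convex hull B" by (intro hull_mono) (auto simp: B_def)
    finally show ?thesis .
  qed
  have zB: "z \<in> convex hull B" if "h None \<noteq> 0"
  proof -
    have "h (Some v) = 0" using diag by (simp add: h_def)
    then have "z v = 0" using z(3)[rule_format, of v] that by simp
    then have "z \<in> convex hull {x \<in> A. - x v = 0}"
      using z(2) assms linear_compose_neg[OF lin]
      by (intro convex_hull_face[where g = "\<lambda>x. - x v"]) (auto simp: FRAC_def)
    also have "\<dots> \<subseteq> convex hull B" by (intro hull_mono) (auto simp: B_def)
    finally show ?thesis .
  qed
  have xe: "x = g None *\<^sub>R y + h None *\<^sub>R z" using x by (auto simp: fun_eq_iff)
  consider "g None = 0" | "h None = 0" | "g None \<noteq> 0" "h None \<noteq> 0" by blast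
  then have "x \<in> convex hull B"
  proof cases
    case 1
    then have "x = z" using xe sum1 by simp
    then show ?thesis using zB 1 sum1 by simp
  next
    case 2
    then have "x = y" using xe sum1 by simp
    then show ?thesis using yB 2 sum1 by simp
  next
    case 3
    then show ?thesis unfolding xe using yB zB y(1) z(1) sum1
      by (intro convexD[OF convex_convex_hull]) auto
  qed
  then show "x \<in> convex hull {x \<in> A. x v \<in> {0, 1}}" by (simp add: B_def)
qed

lemma LS_plus_funpow_card:
  assumes "finite V"
  shows "(LS_plus V ^^ card V) (FRAC V E) = STAB V E"
proof
  have "(LS_plus V ^^ card F) (FRAC V E) \<subseteq> convex hull {x \<in> FRAC V E. \<forall>v\<in>F. x v \<in> {0, 1}}"
    if "finite F" "F \<subseteq> V" for F
    using that
  proof (induction F rule: finite_induct)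
    case empty
    then show ?case by (auto simp: hull_inc)
  next
    case (insert v F)
    have "{x \<in> FRAC V E. \<forall>u\<in>insert v F. x u \<in> {0, 1}}
        = {x \<in> {x \<in> FRAC V E. \<forall>v\<in>F. x v \<in> {0, 1}}. x v \<in> {0, 1}}" by auto
    then show ?case
      using insert LS_plus_subset_convex_hull_split[of v V "{x \<in> FRAC V E. \<forall>v\<in>F. x v \<in> {0, 1}}" E
          "(LS_plus V ^^ card F) (FRAC V E)"] by simp
  qed
  from this[OF assms] show "(LS_plus V ^^ card V) (FRAC V E) \<subseteq> STAB V E"
    by (simp add: STAB_def)
qed (rule STAB_subset_LS_plus_funpow)

section \<open>Symmetric points and their lifts\<close>

lemma finite_H_verts [simp]: "finite (H_verts k)"
  by (simp add: H_verts_def)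

text \<open>
  Indices outside \<open>S\<close> have been fixed by taking \<open>i\<^sub>1\<close> into the stable set. In particular
  \<open>sym_vec k {l} 1 0\<close> is the indicator of the stable set \<open>{l\<^sub>0, l\<^sub>2} \<union> {j\<^sub>1 | j \<noteq> l}\<close>.
\<close>

definition sym_vec :: "nat \<Rightarrow> nat set \<Rightarrow> real \<Rightarrow> real \<Rightarrow> nat \<times> nat \<Rightarrow> real"
  where "sym_vec k S a b = (\<lambda>(i, p).
    if i \<in> S then (if p = 1 then b else if p = 0 \<or> p = 2 then a else 0)
    else if i \<in> {1..k} \<and> p = 1 then 1 else 0)"

text \<open>
  The indicator of \<open>{i\<^sub>q | i \<in> S} \<union> {i\<^sub>1 | i \<notin> S}\<close>, which is stable for \<open>q = 0\<close> and \<open>q = 2\<close>.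
\<close>

definition side_vec :: "nat \<Rightarrow> nat set \<Rightarrow> nat \<Rightarrow> nat \<times> nat \<Rightarrow> real"
  where "side_vec k S q = (\<lambda>(i, p). if i \<in> S then of_bool (p = q) else of_bool (i \<in> {1..k} \<and> p = 1))"

lemma FRAC_H_I:
  assumes "x \<in> vectors (H_verts k)" "\<And>v. 0 \<le> x v" "\<And>v. x v \<le> 1"
    and "\<And>i. i \<in> {1..k} \<Longrightarrow> x (i, 0) + x (i, 1) \<le> 1" "\<And>i. i \<in> {1..k} \<Longrightarrow> x (i, 1) + x (i, 2) \<le> 1"
    and "\<And>i j. i \<in> {1..k} \<Longrightarrow> j \<in> {1..k} \<Longrightarrow> i \<noteq> j \<Longrightarrow> x (i, 0) + x (j, 2) \<le> 1"
  shows "x \<in> FRAC (H_verts k) (H_edges k)"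
proof -
  have sum_eq: "x u + x v = x u' + x v'" if "{u, v} = {u', v'}" for u v u' v'
    using that by (auto simp: doubleton_eq_iff)
  have "x u + x v \<le> 1" if "{u, v} \<in> H_edges k" for u v
    using that assms(4-6) unfolding H_edges_def by (auto dest!: sum_eq)
  then show ?thesis using assms(1-3) by (simp add: FRAC_def)
qed

lemma sym_vec_mem_vectors: "S \<subseteq> {1..k} \<Longrightarrow> sym_vec k S a b \<in> vectors (H_verts k)"
  by (auto simp: sym_vec_def vectors_def H_verts_def)

lemma sym_vec_mem_FRAC:
  assumes "S \<subseteq> {1..k}" "0 \<le> a" "0 \<le> b" "a + b \<le> 1" "a \<le> 1 / 2 \<or> (\<exists>l. S = {l})"
  shows "sym_vec k S a b \<in> FRAC (H_verts k) (H_edges k)"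
  by (intro FRAC_H_I sym_vec_mem_vectors) (use assms in \<open>auto simp: sym_vec_def\<close>)

lemma side_vec_mem_FRAC:
  assumes "S \<subseteq> {1..k}" "q = 0 \<or> q = 2"
  shows "side_vec k S q \<in> FRAC (H_verts k) (H_edges k)"
  by (intro FRAC_H_I) (use assms in \<open>auto simp: side_vec_def vectors_def H_verts_def\<close>)

text \<open>
  The automorphisms of \<open>H\<close> on \<open>S\<close> leave a matrix with diagonal \<open>(a, b, a)\<close> four free parameters.
  They are the entries of \<open>l\<^sub>0\<close> with \<open>l\<^sub>2\<close>, \<open>j\<^sub>0\<close>, \<open>j\<^sub>1\<close> (for \<open>j \<noteq> l\<close>), and of \<open>l\<^sub>1\<close> with \<open>j\<^sub>1\<close>.
  Here the first and the third are both \<open>a - d\<close>, where \<open>d\<close> is the second: these are the largest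
  values for which the column of \<open>l\<^sub>0\<close> satisfies its edge constraints (pairs that are edges get
  the entry 0), and then that column is a combination of just two stable sets.
\<close>

definition lift_block :: "real \<Rightarrow> real \<Rightarrow> real \<Rightarrow> real \<Rightarrow> nat \<times> nat \<Rightarrow> nat \<times> nat \<Rightarrow> real"
  where "lift_block a b d f = (\<lambda>(i, p) (j, q).
    if p \<notin> {0, 1, 2} \<or> q \<notin> {0, 1, 2} then 0
    else if i = j then (if p = q then (if p = 1 then b else a) else if p = 1 \<or> q = 1 then 0 else a - d)
    else if p = 1 \<and> q = 1 then f else if p = 1 \<or> q = 1 then a - d else if p = q then d else 0)"

definition H_lift ::
    "nat \<Rightarrow> nat set \<Rightarrow> real \<Rightarrow> real \<Rightarrow> real \<Rightarrow> real \<Rightarrow>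
      (nat \<times> nat) option \<Rightarrow> (nat \<times> nat) option \<Rightarrow> real"
  where "H_lift k S a b d f u v = (case (u, v) of
      (Some u, Some v) \<Rightarrow> if fst u \<in> S \<and> fst v \<in> S then lift_block a b d f u v
        else sym_vec k S a b u * sym_vec k S a b v
    | _ \<Rightarrow> homog 1 (sym_vec k S a b) u * homog 1 (sym_vec k S a b) v)"

text \<open>
  The vectors \<open>e\<^sub>l - (1, \<dots>, 1) / |S|\<close> are the Gram vectors of the projection onto the sum zero
  vectors on \<open>S\<close>.
\<close>

lemma sum_centered_indicators:
  assumes "finite S" "i \<in> S" "j \<in> S"
  shows "(\<Sum>l\<in>S. (of_bool (i = l) - 1 / real (card S)) * (of_bool (j = l) - 1 / real (card S)))
    = of_bool (i = j) - 1 / real (card S)"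
proof -
  have c: "real (card S) \<noteq> 0" using assms by auto
  have "(\<Sum>l\<in>S. (of_bool (i = l) - 1 / real (card S)) * (of_bool (j = l) - 1 / real (card S)))
    = (\<Sum>l\<in>S. (if i = l then of_bool (i = j) - 1 / real (card S) else 0)
        - (if j = l then 1 / real (card S) else 0) + 1 / (real (card S))\<^sup>2)"
    by (intro sum.cong refl) (auto simp: algebra_simps power2_eq_square)
  also have "\<dots> = of_bool (i = j) - 1 / real (card S)"
    using assms c by (simp add: sum.distrib sum_subtractf power2_eq_square)
  finally show ?thesis .
qed

text \<open>
  The matrix decomposes along the representations of the automorphism group. On vectors that sum
  to 0 over \<open>S\<close> and are even under exchanging \<open>i\<^sub>0\<close> with \<open>i\<^sub>2\<close>, it is the sum over \<open>S\<close> of \<open>(a -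
  d) (u - w)\<^sup>2 + (b - f - (a - d)) w\<^sup>2\<close>, where \<open>w\<close> is the entry at \<open>i\<^sub>1\<close> and \<open>u\<close> the sum of the
  other two; on constant odd vectors it is a multiple of \<open>d\<close>; on sum zero odd vectors it
  vanishes. What is left after subtracting the square of the top row is a form in the two sums
  \<open>U\<close> over all \<open>i\<^sub>0\<close>, \<open>i\<^sub>2\<close> and \<open>W\<close> over all \<open>i\<^sub>1\<close>, with coefficients \<open>\<alpha>\<close>, \<open>\<beta>\<close>, \<open>\<gamma>\<close>.
\<close>

lemma sym_psd_H_lift:
  fixes a b d f :: real
  assumes S: "finite S" "S \<noteq> {}"
    and s: "s = real (card S)"
    and \<alpha>: "\<alpha> = d / 2 + (a - d) / s - a\<^sup>2"
    and \<beta>: "\<beta> = (a - d) * (1 - 1 / s) - a * b"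
    and \<gamma>: "\<gamma> = f + (b - f) / s - b\<^sup>2"
    and pos: "0 \<le> d" "d \<le> a" "a - d \<le> b - f" "0 < \<alpha>" "\<beta>\<^sup>2 \<le> \<alpha> * \<gamma>"
  shows "sym_psd I (H_lift k S a b d f)"
proof -
  define h where "h = homog 1 (sym_vec k S a b)"
  define U :: "(nat \<times> nat) option \<Rightarrow> real"
    where "U = case_option 0 (\<lambda>(i, p). of_bool (i \<in> S \<and> (p = 0 \<or> p = 2)))"
  define W :: "(nat \<times> nat) option \<Rightarrow> real"
    where "W = case_option 0 (\<lambda>(i, p). of_bool (i \<in> S \<and> p = 1))"
  define T :: "(nat \<times> nat) option \<Rightarrow> real"
    where "T = case_option 0 (\<lambda>(i, p). of_bool (i \<in> S) * (of_bool (p = 0) - of_bool (p = 2)))"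
  define c :: "nat \<Rightarrow> (nat \<times> nat) option \<Rightarrow> real"
    where "c = (\<lambda>l. case_option 0 (\<lambda>(i, p). of_bool (i = l) - 1 / s))"
  define g where "g = (\<lambda>l u. c l u * (U u - W u))"
  define r where "r = (\<lambda>l u. c l u * W u)"
  have pos': "0 \<le> a - d" "0 \<le> b - f - (a - d)" "0 \<le> d / 2" using pos by auto
  define G where "G = (\<lambda>u v. (((h u * h v
    + (\<alpha> * (U u * U v) + \<beta> * (U u * W v + W u * U v) + \<gamma> * (W u * W v)))
    + (a - d) * (\<Sum>l\<in>S. g l u * g l v))
    + (b - f - (a - d)) * (\<Sum>l\<in>S. r l u * r l v))
    + d / 2 * (T u * T v))"
  have "sym_psd I G"
    unfolding G_def
    by (intro sym_psd_add sym_psd_scale sym_psd_sum sym_psd_rank_one sym_psd_binary_form pos' pos)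
  moreover have "G u v = H_lift k S a b d f u v" for u v
  proof (cases "\<exists>i p j q. u = Some (i, p) \<and> v = Some (j, q) \<and> i \<in> S \<and> j \<in> S")
    case False
    then have "U u = 0 \<and> W u = 0 \<and> T u = 0 \<or> U v = 0 \<and> W v = 0 \<and> T v = 0"
      by (cases u; cases v) (auto simp: U_def W_def T_def)
    then have "G u v = h u * h v" by (auto simp: G_def g_def r_def)
    also have "\<dots> = H_lift k S a b d f u v"
      using False by (auto simp: H_lift_def h_def homog_def split: option.split)
    finally show ?thesis .
  next
    case True
    then obtain i p j q where uv: "u = Some (i, p)" "v = Some (j, q)" "i \<in> S" "j \<in> S" by blast
    have C: "(\<Sum>l\<in>S. c l u * c l v) = of_bool (i = j) - 1 / s"
      using sum_centered_indicators[OF S(1) uv(3,4)] by (simp add: c_def uv s)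
    have gg: "(\<Sum>l\<in>S. g l u * g l v) = (of_bool (i = j) - 1 / s) * ((U u - W u) * (U v - W v))"
      unfolding C[symmetric] sum_distrib_right by (intro sum.cong) (auto simp: g_def)
    have rr: "(\<Sum>l\<in>S. r l u * r l v) = (of_bool (i = j) - 1 / s) * (W u * W v)"
      unfolding C[symmetric] sum_distrib_right by (intro sum.cong) (auto simp: r_def)
    (* Both sides depend only on the two levels and on whether the indices agree. *)
    have "p = 0 \<or> p = 1 \<or> p = 2 \<or> p \<notin> {0, 1, 2}" "q = 0 \<or> q = 1 \<or> q = 2 \<or> q \<notin> {0, 1, 2}" by auto
    then show ?thesis
      unfolding G_def gg rr using uv(3,4)
      by (elim disjE; cases "i = j";
        simp add: uv U_def W_def T_def h_def homog_def H_lift_def lift_block_def sym_vec_def \<alpha> \<beta> \<gamma>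
          power2_eq_square algebra_simps diff_divide_distrib add_divide_distrib)
  qed
  ultimately show ?thesis by (simp add: sym_psd_def)
qed

text \<open>
  Each column condition is verified by an explicit decomposition. The column of \<open>l\<^sub>1\<close> is a
  symmetric point for \<open>S - {l}\<close>, and the column of \<open>l\<^sub>0\<close> consists of \<open>{l\<^sub>0, l\<^sub>2} \<union> {j\<^sub>1 | j \<noteq>
  l}\<close> with weight \<open>a - d\<close> and \<open>{i\<^sub>0 | i \<in> S}\<close> with weight \<open>d\<close>. The complement of the column of
  \<open>l\<^sub>0\<close> is dominated by \<open>{i\<^sub>2 | i \<in> S}\<close> with weight \<open>d\<close> and a symmetric point for \<open>S - {l}\<close> with
  the remaining weight \<open>\<tau>\<close>. The complement of the column of \<open>l\<^sub>1\<close> is dominated by \<open>{i\<^sub>0 | i \<in>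
  S}\<close> and \<open>{i\<^sub>2 | i \<in> S}\<close> with weight \<open>d\<close> each and \<open>{l\<^sub>0, l\<^sub>2} \<union> {j\<^sub>1 | j \<noteq> l}\<close> with the rest.
  Here the indices outside \<open>S\<close> are understood to contribute \<open>i\<^sub>1\<close> to every stable set.
\<close>

lemma sym_vec_mem_LS_plus:
  fixes a b d f :: real
  assumes S: "S \<subseteq> {1..k}" "S \<noteq> {}" and s: "s = real (card S)"
    and P: "convex P" "zeroing_closed P" "\<And>l. l \<in> S \<Longrightarrow> sym_vec k {l} 1 0 \<in> P"
      "side_vec k S 0 \<in> P" "side_vec k S 2 \<in> P"
    and pos: "0 \<le> d" "d \<le> a" "0 < b" "0 \<le> f" "a - d \<le> b - f" "a - d \<le> b"
    and f: "b - f \<le> 1 - b - 2 * d"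
    and \<tau>: "\<tau> = 1 - a - d" "b \<le> \<tau>"
    and P_del: "\<And>l. l \<in> S \<Longrightarrow> sym_vec k (S - {l}) ((a - d) / b) (f / b) \<in> P"
      "\<And>l. l \<in> S \<Longrightarrow> sym_vec k (S - {l}) ((a - d) / \<tau>) ((b - (a - d)) / \<tau>) \<in> P"
    and \<alpha>: "\<alpha> = d / 2 + (a - d) / s - a\<^sup>2" "0 < \<alpha>"
    and \<beta>: "\<beta> = (a - d) * (1 - 1 / s) - a * b"
    and \<gamma>: "\<gamma> = f + (b - f) / s - b\<^sup>2" "\<beta>\<^sup>2 \<le> \<alpha> * \<gamma>"
  shows "sym_vec k S a b \<in> LS_plus (H_verts k) P"
proof -
  let ?V = "H_verts k"
  define Y where "Y = H_lift k S a b d f"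
  have fin: "finite S" using S(1) finite_subset by blast
  have \<tau>0: "0 < \<tau>" using \<tau> pos by auto
  have sub: "Suc 0 \<le> l" "l \<le> k" if "l \<in> S" for l using S(1) that by auto
  have outside: "\<exists>i p. v = (i, p) \<and> (p \<noteq> 0 \<and> p \<noteq> Suc 0 \<and> p \<noteq> 2 \<or> (i = 0 \<or> k < i) \<and> i \<notin> S)"
    if "v \<notin> ?V" for v
    using that sub by (cases v) (force simp: H_verts_def)
  note Y_simps = sub Y_def H_lift_def lift_block_def sym_vec_def side_vec_def homog_def col_def
  have col1: "col Y (Some (l, 1)) \<in> cone_of P" if l: "l \<in> S" for l
  proof -
    have "col Y (Some (l, 1)) = b *\<^sub>R homog 1 (sym_vec k (S - {l}) ((a - d) / b) (f / b))"
      using l pos(3) by (auto simp: Y_simps fun_eq_iff split: option.split)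
    then show ?thesis using P_del(1)[OF l] pos(3) by (simp add: cone_of_scale cone_of_homog_1)
  qed
  have col02: "col Y (Some (l, q)) \<in> cone_of P" if l: "l \<in> S" and q: "q = 0 \<or> q = 2" for l q
  proof -
    have "col Y (Some (l, q)) = (a - d) *\<^sub>R homog 1 (sym_vec k {l} 1 0) + d *\<^sub>R homog 1 (side_vec k S q)"
      using l q by (auto simp: Y_simps fun_eq_iff split: option.split)
    then show ?thesis using P l q pos
      by (auto intro!: cone_of_add cone_of_scale cone_of_homog_1)
  qed
  have compl02: "col Y None - col Y (Some (l, q)) \<in> cone_of P"
    if l: "l \<in> S" and q: "q = 0 \<or> q = 2" for l q
  proof -
    let ?h = "d *\<^sub>R homog 1 (side_vec k S (2 - q))
      + \<tau> *\<^sub>R homog 1 (sym_vec k (S - {l}) ((a - d) / \<tau>) ((b - (a - d)) / \<tau>))"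
    have h: "?h \<in> cone_of P"
      using P(1,4,5) P_del(2)[OF l] q pos \<tau>0
      by (auto intro!: cone_of_add cone_of_scale cone_of_homog_1)
    show ?thesis
    proof (rule cone_of_down[OF finite_H_verts P(1,2) h, of _ k])
      fix v assume v: "v \<notin> ?V"
      show "(col Y None - col Y (Some (l, q))) (Some v) = ?h (Some v)"
        using outside[OF v] l q by (auto simp: Y_simps)
    qed (use l q pos \<tau> \<tau>0 in \<open>auto simp: Y_simps H_verts_def\<close>)
  qed
  have compl1: "col Y None - col Y (Some (l, 1)) \<in> cone_of P" if l: "l \<in> S" for l
  proof -
    let ?h = "d *\<^sub>R homog 1 (side_vec k S 0) + d *\<^sub>R homog 1 (side_vec k S 2)
      + (1 - b - 2 * d) *\<^sub>R homog 1 (sym_vec k {l} 1 0)"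
    have h: "?h \<in> cone_of P"
      using P l pos f \<tau> by (auto intro!: cone_of_add cone_of_scale cone_of_homog_1)
    show ?thesis
    proof (rule cone_of_down[OF finite_H_verts P(1,2) h, of _ k])
      fix v assume v: "v \<notin> ?V"
      show "(col Y None - col Y (Some (l, 1))) (Some v) = ?h (Some v)"
        using outside[OF v] l by (auto simp: Y_simps)
    qed (use l pos \<tau> f in \<open>auto simp: Y_simps H_verts_def\<close>)
  qed
  have colN: "col Y None \<in> cone_of P"
  proof -
    obtain l where "l \<in> S" using S(2) by blast
    then have "col Y (Some (l, 1)) + (col Y None - col Y (Some (l, 1))) \<in> cone_of P"
      using col1 compl1 P(1) by (intro cone_of_add)
    then show ?thesis by simp
  qed
  have "col Y (Some v) \<in> cone_of P \<and> col Y None - col Y (Some v) \<in> cone_of P" if v: "v \<in> ?V" for v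
  proof -
    obtain l p where lp: "v = (l, p)" "l \<in> {1..k}" "p = 0 \<or> p = 1 \<or> p = 2"
      using v by (auto simp: H_verts_def)
    show ?thesis
    proof (cases "l \<in> S")
      case True
      then show ?thesis using lp(3) col1 col02 compl1 compl02 unfolding lp(1) by blast
    next
      case False
      (* A fixed vertex has value 0 or 1, so its column is 0 or the column of the constant 1. *)
      have "col Y (Some v) = of_bool (p = 1) *\<^sub>R col Y None"
        using lp False by (auto simp: Y_simps fun_eq_iff split: option.split)
      then show ?thesis using colN by (auto intro!: cone_of_zero dest: cone_of_nonempty)
    qed
  qed
  moreover have "Y \<in> matrices (homog_indices ?V)"
  proof -
    have "Y u v = 0 \<and> Y v u = 0" if u: "u \<notin> homog_indices ?V" for u v
    proof -
      obtain w where w: "u = Some w" "w \<notin> ?V"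
        using u by (cases u) (auto simp: homog_indices_def)
      then show ?thesis using outside[OF w(2)] by (auto simp: Y_simps split: option.split)
    qed
    then show ?thesis unfolding matrices_def by blast
  qed
  moreover have "sym_psd (homog_indices ?V) Y"
    unfolding Y_def using pos \<alpha>(2) \<gamma>(2)
    by (intro sym_psd_H_lift[OF fin S(2) s \<alpha>(1) \<beta> \<gamma>(1)])
  moreover have "col Y None = diag Y"
    by (auto simp: Y_simps diag_def fun_eq_iff split: option.split)
  ultimately have "Y \<in> LS_plus_lift ?V P" by (auto simp: LS_plus_lift_def)
  moreover have "col Y None = homog 1 (sym_vec k S a b)"
    by (auto simp: Y_simps fun_eq_iff split: option.split)
  ultimately show ?thesis using sym_vec_mem_vectors[OF S(1)] by (auto simp: LS_plus_def)
qed

section \<open>One round near the vertex\<close>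

lemma sym_vec_down:
  assumes "S \<subseteq> {1..k}" "convex P" "zeroing_closed P" "sym_vec k S a b \<in> P" "0 \<le> a" "0 \<le> b'" "b' \<le> b"
  shows "sym_vec k S a b' \<in> P"
  by (rule zeroing_closed_imp_down_closed[OF finite_H_verts[of k] assms(2-4)])
    (use assms in \<open>auto simp: sym_vec_def H_verts_def split: if_splits\<close>)

lemma eventually_pos_at_right:
  fixes g :: "real \<Rightarrow> real"
  assumes "isCont g 0" "0 < g 0"
  shows "\<forall>\<^sub>F \<delta> in at_right 0. 0 < g \<delta>"
proof -
  have "(g \<longlongrightarrow> g 0) (at_right 0)"
    using assms(1) by (simp add: isCont_def filterlim_at_split)
  then show ?thesis using assms(2) by (rule order_tendstoD)
qed

lemma filterlim_scaled_at_right: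
  fixes g :: "real \<Rightarrow> real"
  assumes "isCont g 0" "0 < g 0" "0 < c"
  shows "filterlim (\<lambda>\<delta>. c * \<delta> / g \<delta>) (at_right 0) (at_right 0)"
proof (rule tendsto_imp_filterlim_at_right)
  have "isCont (\<lambda>\<delta>. c * \<delta> / g \<delta>) 0" using assms by (intro continuous_intros) auto
  then show "((\<lambda>\<delta>. c * \<delta> / g \<delta>) \<longlongrightarrow> 0) (at_right 0)"
    by (simp add: isCont_def filterlim_at_split)
  show "\<forall>\<^sub>F \<delta> in at_right 0. 0 < c * \<delta> / g \<delta>"
    using eventually_pos_at_right[OF assms(1,2)] eventually_at_right_less[of 0]
    by eventually_elim (use assms(3) in simp)
qed

text \<open>
  On \<open>n + 1\<close> free indices the vertex is \<open>(1 / (n + 1), n / (n + 1))\<close>, and \<open>\<delta>\<close> is the distance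
  from it in the coordinate \<open>a\<close>. The lift takes \<open>d = 4 \<delta> / n\<close>: a positive form requires \<open>d\<close> to
  exceed about \<open>2 \<delta> / n\<close>, while the complement conditions get worse as \<open>d\<close> grows, and twice that
  minimum is a simple compromise. The parameter \<open>f\<close> is as large as the induction hypothesis for
  the column of \<open>l\<^sub>1\<close> permits, namely with the normalized column exactly on the line of slope \<open>-
  m'\<close>.

  The hypotheses on \<open>m\<close> and \<open>m'\<close> are the first order parts of the conditions of the lift. The
  first gives \<open>a - d \<le> b - f\<close>, the second to fourth make the two complement decompositions work,
  and the last one is \<open>\<beta>\<^sup>2 < \<alpha> \<gamma>\<close>. It is strict to absorb the second order terms.
\<close>

lemma eventually_sym_vec_mem_LS_plus:
  fixes n :: nat and m m' :: real
  assumes n: "5 \<le> n"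
    and P: "convex P" "zeroing_closed P" "\<And>l. l \<in> {1..k} \<Longrightarrow> sym_vec k {l} 1 0 \<in> P"
      "\<And>S q. S \<subseteq> {1..k} \<Longrightarrow> q \<in> {0, 2} \<Longrightarrow> side_vec k S q \<in> P"
    and IH: "\<forall>\<^sub>F \<delta> in at_right 0. \<forall>S\<subseteq>{1..k}. card S = n \<longrightarrow>
      sym_vec k S (1 / n + \<delta>) ((n - 1) / n - m' * \<delta>) \<in> P"
    and m: "1 \<le> m'" "1 + 4 / n \<le> m"
      "m' * (m - 4) - m + 8 \<le> n * (m - m')"
      "7 - 4 / n - m' * (3 - 4 / n) \<le> n * (m - m')"
      "(4 - m)\<^sup>2 < (n - 2) / n * (n * (m - m') - m' * (m - 4))"
  shows "\<forall>\<^sub>F \<delta> in at_right 0. \<forall>S\<subseteq>{1..k}. card S = Suc n \<longrightarrow>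
      sym_vec k S (1 / Suc n + \<delta>) (n / Suc n - m * \<delta>) \<in> LS_plus (H_verts k) P"
proof -
  define N where "N = real n"
  have N: "5 \<le> N" "N \<noteq> 0" "N + 1 \<noteq> 0" using n by (auto simp: N_def)
  (* The normalized column of l_1 and complement of the column of l_0 exceed 1 / n in the
     coordinate a by \<kappa> \<delta> / b and \<mu> \<delta> / \<tau>, see eb and e\<tau> below. *)
  define \<kappa> \<mu> where "\<kappa> = 1 - 4 / N + m / N" and "\<mu> = 1 - 4 / N + (1 + 4 / N) / N"
  define a where "a = (\<lambda>\<delta>. 1 / (N + 1) + \<delta>)"
  define b where "b = (\<lambda>\<delta>. N / (N + 1) - m * \<delta>)"
  define e where "e = (\<lambda>\<delta>. 1 / (N + 1) + (1 - 4 / N) * \<delta>)"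
  define f where "f = (\<lambda>\<delta>. b \<delta> * ((N - 1) / N) - m' * \<kappa> * \<delta>)"
  define \<tau> where "\<tau> = (\<lambda>\<delta>. N / (N + 1) - (1 + 4 / N) * \<delta>)"
  define \<alpha> where "\<alpha> = (\<lambda>\<delta>. (N - 2) / (N * (N + 1)) - \<delta>)"
  define \<beta> where "\<beta> = (\<lambda>\<delta>. (m - 4) / (N + 1) + m * \<delta>)"
  define \<gamma> where "\<gamma> = (\<lambda>\<delta>. (m * N - m' * (N - 4 + m)) / (N + 1) - m\<^sup>2 * \<delta>)"
  (* \<alpha>, \<beta>, \<gamma> are the coefficients of the binary form divided by \<delta>. *)
  note defs = a_def b_def e_def f_def \<tau>_def \<alpha>_def \<beta>_def \<gamma>_def
  have m_pos: "1 \<le> m" using m(2) n by (smt (verit) divide_nonneg_nonneg of_nat_0_le_iff)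
  have "4 / N < 1" using N by simp
  then have \<kappa>: "0 < \<kappa>" and \<mu>: "0 < \<mu>"
    using m_pos N by (auto simp: \<kappa>_def \<mu>_def intro!: add_pos_nonneg)
  have form0: "(\<beta> 0)\<^sup>2 < \<alpha> 0 * \<gamma> 0"
  proof -
    have "(m - 4)\<^sup>2 < (N - 2) / N * (m * N - m' * (N - 4 + m))"
      using m(5) n by (simp add: N_def algebra_simps of_nat_diff power2_commute)
    then have "(m - 4)\<^sup>2 / (N + 1)\<^sup>2 < (N - 2) / N * (m * N - m' * (N - 4 + m)) / (N + 1)\<^sup>2"
      using N by (intro divide_strict_right_mono) auto
    then show ?thesis by (simp add: \<alpha>_def \<beta>_def \<gamma>_def power2_eq_square mult.assoc)
  qed
  have pos: "\<forall>\<^sub>F \<delta> in at_right 0. 0 < g \<delta>" if "isCont g 0" "0 < g 0" for g :: "real \<Rightarrow> real"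
    using that by (rule eventually_pos_at_right)
  have lim: "filterlim (\<lambda>\<delta>. \<kappa> * \<delta> / b \<delta>) (at_right 0) (at_right 0)"
    "filterlim (\<lambda>\<delta>. \<mu> * \<delta> / \<tau> \<delta>) (at_right 0) (at_right 0)"
    using N \<kappa> \<mu> by (auto intro!: filterlim_scaled_at_right continuous_intros simp: b_def \<tau>_def)
  have "\<forall>\<^sub>F \<delta> in at_right 0. 0 < (\<delta> :: real)" by (rule eventually_at_right_less)
  moreover have "\<forall>\<^sub>F \<delta> in at_right 0. 0 < b \<delta>"
    using N by (intro pos) (auto simp: defs intro!: continuous_intros)
  moreover have "\<forall>\<^sub>F \<delta> in at_right 0. 0 < f \<delta>"
    using N by (intro pos) (auto simp: defs intro!: continuous_intros)
  moreover have "\<forall>\<^sub>F \<delta> in at_right 0. 0 < b \<delta> - e \<delta>"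
    using N by (intro pos) (auto simp: defs diff_divide_distrib[symmetric] intro!: continuous_intros)
  moreover have "\<forall>\<^sub>F \<delta> in at_right 0. 0 < \<alpha> \<delta>"
    using N by (intro pos) (auto simp: defs intro!: continuous_intros)
  moreover have "\<forall>\<^sub>F \<delta> in at_right 0. 0 < \<alpha> \<delta> * \<gamma> \<delta> - (\<beta> \<delta>)\<^sup>2"
    using N form0 by (intro pos) (auto simp: \<alpha>_def \<beta>_def \<gamma>_def intro!: continuous_intros)
  moreover note eventually_compose_filterlim[OF IH lim(1)] eventually_compose_filterlim[OF IH lim(2)]
  ultimately show ?thesis
  proof eventually_elim
    case (elim \<delta>)
    note \<delta> = elim(1)
    define d where "d = 4 / N * \<delta>"
    have e: "a \<delta> - d = e \<delta>" by (simp add: defs d_def algebra_simps)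
    have eb: "e \<delta> / b \<delta> = 1 / N + \<kappa> * \<delta> / b \<delta>"
    proof -
      have "e \<delta> = b \<delta> / N + \<kappa> * \<delta>"
        using N by (simp add: defs \<kappa>_def divide_simps; simp add: algebra_simps)
      then show ?thesis using elim(2) N by (simp add: field_simps)
    qed
    have fb: "f \<delta> / b \<delta> = (N - 1) / N - m' * (\<kappa> * \<delta> / b \<delta>)"
      using elim(2) by (simp add: f_def diff_divide_distrib)
    have b\<tau>: "b \<delta> \<le> \<tau> \<delta>"
      using m(2) \<delta> by (simp add: defs N_def)
    then have \<tau>_pos: "0 < \<tau> \<delta>" using elim(2) by simp
    have e\<tau>: "e \<delta> / \<tau> \<delta> = 1 / N + \<mu> * \<delta> / \<tau> \<delta>"
    proof -
      have "e \<delta> = \<tau> \<delta> / N + \<mu> * \<delta>"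
        using N by (simp add: defs \<mu>_def divide_simps; simp add: algebra_simps)
      then show ?thesis using \<tau>_pos N by (simp add: field_simps)
    qed
    have be\<tau>: "(b \<delta> - e \<delta>) / \<tau> \<delta> \<le> (N - 1) / N - m' * (\<mu> * \<delta> / \<tau> \<delta>)"
    proof -
      have "0 \<le> (m + 1 - 4 / N) - (1 + 4 / N) * ((N - 1) / N) - m' * \<mu>"
        using m(4) N by (simp add: N_def[symmetric] \<mu>_def divide_simps; simp add: algebra_simps) 
      then have "0 \<le> ((m + 1 - 4 / N) - (1 + 4 / N) * ((N - 1) / N) - m' * \<mu>) * \<delta>"
        using \<delta> by simp
      also have "\<dots> = \<tau> \<delta> * ((N - 1) / N) - m' * \<mu> * \<delta> - (b \<delta> - e \<delta>)"
        using N by (simp add: defs divide_simps; simp add: algebra_simps)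
      finally have "b \<delta> - e \<delta> \<le> \<tau> \<delta> * ((N - 1) / N) - m' * \<mu> * \<delta>" by simp
      then have "(b \<delta> - e \<delta>) / \<tau> \<delta> \<le> (\<tau> \<delta> * ((N - 1) / N) - m' * \<mu> * \<delta>) / \<tau> \<delta>"
        using \<tau>_pos by (intro divide_right_mono) auto
      then show ?thesis using \<tau>_pos by (simp add: diff_divide_distrib)
    qed
    have bf: "b \<delta> - f \<delta> = e \<delta> + (m' - 1) * \<kappa> * \<delta>"
      using N by (simp add: defs \<kappa>_def divide_simps; simp add: algebra_simps)
    have "0 \<le> (m' - 1) * \<kappa> * \<delta>" using m(1) \<kappa> \<delta> by simp
    then have ebf: "e \<delta> \<le> b \<delta> - f \<delta>" using bf by simp
    have bf_le: "b \<delta> - f \<delta> \<le> 1 - b \<delta> - 2 * d"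
    proof -
      have "0 \<le> (n * (m - m') - (m' * (m - 4) - m + 8)) / N * \<delta>" using m(3) N \<delta> by simp
      also have "\<dots> = (1 - b \<delta> - 2 * d) - (b \<delta> - f \<delta>)"
        unfolding bf using N by (simp add: defs d_def \<kappa>_def N_def[symmetric] divide_simps; simp add: algebra_simps)
      finally show ?thesis by simp
    qed
    have ed: "0 \<le> d" "0 \<le> e \<delta>" using \<delta> N by (auto simp: d_def e_def)
    have \<alpha>_eq: "\<delta> * \<alpha> \<delta> = d / 2 + (a \<delta> - d) / (N + 1) - (a \<delta>)\<^sup>2"
      using N by (simp add: defs d_def divide_simps; simp add: algebra_simps power2_eq_square)
    have \<beta>_eq: "\<delta> * \<beta> \<delta> = (a \<delta> - d) * (1 - 1 / (N + 1)) - a \<delta> * b \<delta>"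
      using N unfolding e by (simp add: defs divide_simps; simp add: algebra_simps power2_eq_square)
    have \<gamma>_eq: "\<delta> * \<gamma> \<delta> = f \<delta> + (b \<delta> - f \<delta>) / (N + 1) - (b \<delta>)\<^sup>2"
      using N by (simp add: defs \<kappa>_def divide_simps; simp add: algebra_simps power2_eq_square)
    have form: "(\<delta> * \<beta> \<delta>)\<^sup>2 \<le> \<delta> * \<alpha> \<delta> * (\<delta> * \<gamma> \<delta>)"
    proof -
      have "\<delta>\<^sup>2 * (\<beta> \<delta>)\<^sup>2 \<le> \<delta>\<^sup>2 * (\<alpha> \<delta> * \<gamma> \<delta>)" using elim(6) by (intro mult_left_mono) auto
      then show ?thesis by (simp add: power2_eq_square mult_ac)
    qed
    show ?case
    proof (intro allI impI)
      fix S assume S: "S \<subseteq> {1..k}" "card S = Suc n"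
      have fin: "finite S" using S(1) finite_subset by blast
      have S_del: "S - {l} \<subseteq> {1..k}" "card (S - {l}) = n" if "l \<in> S" for l
        using S fin that by auto
      have "sym_vec k S (a \<delta>) (b \<delta>) \<in> LS_plus (H_verts k) P"
      proof (rule sym_vec_mem_LS_plus[OF S(1) _ _ P(1,2), where d = d and f = "f \<delta>" and \<tau> = "\<tau> \<delta>"
            and \<alpha> = "\<delta> * \<alpha> \<delta>" and \<beta> = "\<delta> * \<beta> \<delta>" and \<gamma> = "\<delta> * \<gamma> \<delta>"])
        show "N + 1 = real (card S)" using S(2) by (simp add: N_def)
        show "sym_vec k {l} 1 0 \<in> P" if "l \<in> S" for l using P(3) S(1) that by auto
        show "\<tau> \<delta> = 1 - a \<delta> - d" using N by (simp add: defs d_def divide_simps; simp add: algebra_simps)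
        show "sym_vec k (S - {l}) ((a \<delta> - d) / b \<delta>) (f \<delta> / b \<delta>) \<in> P" if "l \<in> S" for l
          using elim(7) S_del[OF that] n unfolding e eb fb N_def by (simp add: of_nat_diff)
        show "sym_vec k (S - {l}) ((a \<delta> - d) / \<tau> \<delta>) ((b \<delta> - (a \<delta> - d)) / \<tau> \<delta>) \<in> P" if "l \<in> S" for l
        proof (rule sym_vec_down[OF S_del(1)[OF that] P(1,2)])
          show "sym_vec k (S - {l}) ((a \<delta> - d) / \<tau> \<delta>) ((N - 1) / N - m' * (\<mu> * \<delta> / \<tau> \<delta>)) \<in> P"
            using elim(8) S_del[OF that] n unfolding e e\<tau> N_def by (simp add: of_nat_diff)
        qed (use be\<tau> e ed \<tau>_pos elim(4) in auto)
        show "S \<noteq> {}" using S(2) by auto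
        show "side_vec k S 0 \<in> P" "side_vec k S 2 \<in> P" using P(4) S(1) by auto
        show "d \<le> a \<delta>" "a \<delta> - d \<le> b \<delta> - f \<delta>" "a \<delta> - d \<le> b \<delta>"
          using e ed ebf elim(4) by auto
        show "0 \<le> f \<delta>" "0 < \<delta> * \<alpha> \<delta>" using elim(3,5) \<delta> by auto
      qed (fact ed(1) elim(2) bf_le b\<tau> \<alpha>_eq \<beta>_eq \<gamma>_eq form)+
      then show "sym_vec k S (1 / Suc n + \<delta>) (n / Suc n - m * \<delta>) \<in> LS_plus (H_verts k) P"
        by (simp add: a_def b_def N_def add.commute)
    qed
  qed
qed

section \<open>The slope after several rounds\<close>

text \<open>
  For a large number \<open>n\<close> of indices the conditions on the slopes \<open>m\<close> and \<open>m'\<close> become a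
  differential inequality for \<open>m\<close> in terms of \<open>x = p / n\<close>, which forces \<open>dm/dx \<ge> 6\<close> at \<open>m = 1\<close>
  and less for larger \<open>m\<close>. The function \<open>1 + 6 x / (1 + x)\<close> satisfies it up to \<open>x = 1/5\<close>, where
  it reaches 2.
\<close>

definition slope :: "real \<Rightarrow> real \<Rightarrow> real"
  where "slope p n = 1 + 6 * p / (n + p)"

text \<open>
  With \<open>q = p - 1\<close> and \<open>r = n - 5 p\<close> all differences become quotients of polynomials in \<open>q, r \<ge>
  0\<close> with nonnegative coefficients.
\<close>

lemma slope_step:
  fixes p n :: real
  assumes "1 \<le> p" "5 * p \<le> n" and m: "m = slope p n" and m': "m' = slope (p - 1) (n - 1)"
  shows "1 \<le> m'" "1 + 4 / n \<le> m"
    "m' * (m - 4) - m + 8 \<le> n * (m - m')"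
    "7 - 4 / n - m' * (3 - 4 / n) \<le> n * (m - m')"
    "(4 - m)\<^sup>2 < (n - 2) / n * (n * (m - m') - m' * (m - 4))"
proof -
  define q r where "q = p - 1" and "r = n - 5 * p"
  have qr: "0 \<le> q" "0 \<le> r" using assms by (auto simp: q_def r_def)
  have p: "p = q + 1" and n: "n = 5 * q + r + 5" by (auto simp: q_def r_def)
  define N M where "N = 6 * q + r + 6" and "M = 6 * q + r + 4"
  have pos: "0 < N" "0 < M" "0 < n" using qr by (auto simp: N_def M_def n)
  have mN: "m = (12 * q + r + 12) / N"
    unfolding m slope_def using pos(1) by (simp add: p n N_def field_simps)
  have m'M: "m' = (12 * q + r + 4) / M"
    unfolding m' slope_def using pos(2) by (simp add: p n M_def field_simps)
  show "1 \<le> m'" using qr pos by (simp add: m'M M_def field_simps)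
  have "m - (1 + 4 / n) = (30 * q\<^sup>2 + 6 * q * r + 36 * q + 2 * r + 6) / (N * n)"
    unfolding mN using pos by (simp add: divide_simps; simp add: N_def n algebra_simps power2_eq_square)
  also have "\<dots> \<ge> 0" using qr pos by simp
  finally show "1 + 4 / n \<le> m" by simp
  have "n * (m - m') - (m' * (m - 4) - m + 8)
      = (48 * q\<^sup>2 + 24 * q * r + 72 * q + 2 * r\<^sup>2 + 14 * r + 24) / (N * M)"
    unfolding mN m'M using pos
    by (simp add: divide_simps; simp add: N_def M_def n algebra_simps power2_eq_square)
  also have "\<dots> \<ge> 0" using qr pos by simp
  finally show "m' * (m - 4) - m + 8 \<le> n * (m - m')" by simp
  have "n * (m - m') - (7 - 4 / n - m' * (3 - 4 / n))
      = (420 * q ^ 3 + 204 * q\<^sup>2 * r + 816 * q\<^sup>2 + 34 * q * r\<^sup>2 + 274 * q * r + 516 * q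
        + 2 * r ^ 3 + 24 * r\<^sup>2 + 94 * r + 120) / (n * (N * M))"
    unfolding mN m'M using pos
    by (simp add: divide_simps; simp add: N_def M_def n algebra_simps power2_eq_square power3_eq_cube)
  also have "\<dots> \<ge> 0" using qr pos by simp
  finally show "7 - 4 / n - m' * (3 - 4 / n) \<le> n * (m - m')" by simp
  have "(n - 2) / n * (n * (m - m') - m' * (m - 4)) - (4 - m)\<^sup>2
      = (3600 * q ^ 4 + 2220 * q ^ 3 * r + 9792 * q ^ 3 + 450 * q\<^sup>2 * r\<^sup>2 + 4140 * q\<^sup>2 * r
        + 8928 * q\<^sup>2 + 30 * q * r ^ 3 + 462 * q * r\<^sup>2 + 2100 * q * r + 2880 * q
        + 6 * r ^ 3 + 60 * r\<^sup>2 + 180 * r + 144) / (n * (N * (N * M)))"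
    unfolding mN m'M power2_eq_square using pos
    by (simp add: divide_simps; simp add: N_def M_def n algebra_simps power2_eq_square
        power3_eq_cube power4_eq_xxxx)
  also have "\<dots> > 0" using qr pos by (intro divide_pos_pos add_nonneg_pos add_nonneg_nonneg mult_pos_pos) auto
  finally show "(4 - m)\<^sup>2 < (n - 2) / n * (n * (m - m') - m' * (m - 4))" by simp
qed

text \<open>
  The slope for \<open>p\<close> rounds on \<open>n + 1\<close> free indices comes from the one for \<open>p - 1\<close> rounds on \<open>n\<close>.
  The condition \<open>5 p \<le> n\<close> is inherited by \<open>p - 1\<close> and \<open>n - 1\<close>.
\<close>

lemma eventually_sym_vec_mem_LS_plus_funpow:
  assumes "2 \<le> n" "5 * p \<le> n"
  shows "\<forall>\<^sub>F \<delta> in at_right 0. \<forall>S\<subseteq>{1..k}. card S = Suc n \<longrightarrow>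
    sym_vec k S (1 / Suc n + \<delta>) (n / Suc n - slope p n * \<delta>)
      \<in> (LS_plus (H_verts k) ^^ p) (FRAC (H_verts k) (H_edges k))"
  using assms
proof (induction p arbitrary: n)
  case 0
  have "\<forall>\<^sub>F \<delta> in at_right 0. 0 < n / Suc n - \<delta>"
    using 0 by (intro eventually_pos_at_right continuous_intros) auto
  moreover have "\<forall>\<^sub>F \<delta> in at_right 0. 0 < 1 / 2 - 1 / Suc n - (\<delta> :: real)"
    using 0 by (intro eventually_pos_at_right continuous_intros) (auto simp: field_simps)
  moreover have "\<forall>\<^sub>F \<delta> in at_right 0. 0 < (\<delta> :: real)" by (rule eventually_at_right_less)
  ultimately show ?case
  proof eventually_elim
    case (elim \<delta>)
    have "1 / real (Suc n) + \<delta> + (n / Suc n - 1 * \<delta>) = 1" by (simp add: divide_simps)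
    then show ?case
      using elim by (auto simp: slope_def intro!: sym_vec_mem_FRAC)
  qed
next
  case (Suc p)
  let ?P = "(LS_plus (H_verts k) ^^ p) (FRAC (H_verts k) (H_edges k))"
  obtain n' where n': "n = Suc n'" using Suc.prems by (cases n) auto
  have IH: "\<forall>\<^sub>F \<delta> in at_right 0. \<forall>S\<subseteq>{1..k}. card S = n \<longrightarrow>
      sym_vec k S (1 / n + \<delta>) ((n - 1) / n - slope p (real n - 1) * \<delta>) \<in> ?P"
    using Suc.IH[of n'] Suc.prems by (simp add: n')
  have "sym_vec k {l} 1 0 \<in> ?P" if "l \<in> {1..k}" for l
    using that by (intro zero_one_mem_LS_plus_funpow sym_vec_mem_FRAC) (auto simp: sym_vec_def split: if_splits)
  moreover have "side_vec k S q \<in> ?P" if "S \<subseteq> {1..k}" "q \<in> {0, 2}" for S q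
    using that by (intro zero_one_mem_LS_plus_funpow side_vec_mem_FRAC) (auto simp: side_vec_def split: if_splits)
  moreover have "1 \<le> real (Suc p)" "5 * real (Suc p) \<le> real n" using Suc.prems by auto
  note slope_step[OF this refl refl]
  ultimately show ?case
    using Suc.prems IH
      eventually_sym_vec_mem_LS_plus[OF _ convex_LS_plus_funpow zeroing_closed_LS_plus_funpow,
        where n = n and m = "slope (Suc p) n" and m' = "slope p (real n - 1)" and p1 = p]
    by simp
qed

section \<open>The lower bound\<close>

text \<open>
  If a stable set contains both some \<open>i\<^sub>0\<close> and some \<open>j\<^sub>2\<close>, then \<open>i = j\<close> and it contains no other
  vertex of these two kinds. It then has weight at most \<open>2 (k-1) + (k-1) (k-2)\<close>. Otherwise each
  index contributes at most \<open>k-1\<close>. Both bounds equal \<open>k (k-1)\<close>.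
\<close>

lemma STAB_H_valid:
  assumes "x \<in> STAB (H_verts k) (H_edges k)"
  shows "(\<Sum>i\<in>{1..k}. (real k - 1) * (x (i, 0) + x (i, 2)) + (real k - 2) * x (i, 1)) \<le> k * (real k - 1)"
proof -
  define \<Phi> where "\<Phi> = (\<lambda>x :: nat \<times> nat \<Rightarrow> real.
    \<Sum>i\<in>{1..k}. (real k - 1) * (x (i, 0) + x (i, 2)) + (real k - 2) * x (i, 1))"
  have lin: "\<Phi> (r *\<^sub>R x + s *\<^sub>R y) = r * \<Phi> x + s * \<Phi> y" for r s x y
    unfolding \<Phi>_def sum_distrib_left sum.distrib[symmetric]
    by (intro sum.cong refl) (simp add: algebra_simps)
  have "convex {x. \<Phi> x \<le> k * (real k - 1)}"
    by (intro convexI) (auto simp: lin intro!: convex_bound_le)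
  moreover have "\<Phi> x \<le> k * (real k - 1)"
    if x: "x \<in> FRAC (H_verts k) (H_edges k)" "\<forall>v\<in>H_verts k. x v \<in> {0, 1}" for x
  proof -
    have x01: "x (i, p) = 0 \<or> x (i, p) = 1" if "i \<in> {1..k}" "p \<in> {0, 1, 2}" for i p
      using x(2) that by (auto simp: H_verts_def)
    have edge: "x u + x v \<le> 1" if "{u, v} \<in> H_edges k" for u v
      using x(1) that unfolding FRAC_def by blast
    have edges: "x (i, 0) + x (i, 1) \<le> 1" "x (i, 1) + x (i, 2) \<le> 1" if "i \<in> {1..k}" for i
      using that by (intro edge; auto simp: H_edges_def)+
    have cross: "x (i, 0) + x (j, 2) \<le> 1" if "i \<in> {1..k}" "j \<in> {1..k}" "i \<noteq> j" for i j
      using that by (intro edge) (auto simp: H_edges_def)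
    show ?thesis
    proof (cases "\<exists>i\<in>{1..k}. x (i, 0) = 1 \<and> x (i, 2) = 1")
      case True
      then obtain i where i: "i \<in> {1..k}" "x (i, 0) = 1" "x (i, 2) = 1" by blast
      have "x (i, 1) = 0" using edges(1)[OF i(1)] x01[OF i(1), of 1] i by auto
      moreover have "(\<Sum>j\<in>{1..k}-{i}. (real k - 1) * (x (j, 0) + x (j, 2)) + (real k - 2) * x (j, 1))
          \<le> (\<Sum>j\<in>{1..k}-{i}. real k - 2)"
      proof (rule sum_mono)
        fix j assume j: "j \<in> {1..k} - {i}"
        then have "x (j, 0) = 0" "x (j, 2) = 0"
          using cross[of j i] cross[of i j] i x01[of j 0] x01[of j 2] by auto
        moreover have "2 \<le> k" using i(1) j by auto
        moreover have "x (j, 1) \<le> 1" using x01[of j 1] j by auto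
        ultimately show "(real k - 1) * (x (j, 0) + x (j, 2)) + (real k - 2) * x (j, 1) \<le> real k - 2"
          using mult_left_mono[of "x (j, 1)" 1 "real k - 2"] by simp
      qed
      ultimately show ?thesis
        unfolding \<Phi>_def using i
        by (subst sum.remove[of _ i]) (auto simp: of_nat_diff algebra_simps)
    next
      case False
      have "\<Phi> x \<le> (\<Sum>i\<in>{1..k}. real k - 1)"
        unfolding \<Phi>_def
      proof (rule sum_mono)
        fix i assume i: "i \<in> {1..k}"
        have "x (i, 0) + x (i, 2) = 0 \<and> x (i, 1) \<in> {0, 1} \<or> x (i, 0) + x (i, 2) = 1 \<and> x (i, 1) = 0"
          using x01[OF i, of 0] x01[OF i, of 1] x01[OF i, of 2] edges[OF i] False i by auto
        then show "(real k - 1) * (x (i, 0) + x (i, 2)) + (real k - 2) * x (i, 1) \<le> real k - 1"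
          using i by auto
      qed
      then show ?thesis by simp
    qed
  qed
  ultimately have "STAB (H_verts k) (H_edges k) \<subseteq> {x. \<Phi> x \<le> k * (real k - 1)}"
    unfolding STAB_def by (intro hull_minimal) auto
  then show ?thesis using assms by (auto simp: \<Phi>_def)
qed

lemma LS_plus_funpow_H_neq_STAB:
  assumes "3 \<le> k" "5 * p + 1 \<le> k"
  shows "(LS_plus (H_verts k) ^^ p) (FRAC (H_verts k) (H_edges k)) \<noteq> STAB (H_verts k) (H_edges k)"
proof
  assume eq: "(LS_plus (H_verts k) ^^ p) (FRAC (H_verts k) (H_edges k)) = STAB (H_verts k) (H_edges k)"
  define n where "n = k - 1"
  have n: "k = Suc n" "2 \<le> n" "5 * p \<le> n" using assms by (auto simp: n_def)
  have "\<forall>\<^sub>F \<delta> in at_right (0 :: real). 0 < \<delta> \<and>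
      sym_vec k {1..k} (1 / Suc n + \<delta>) (n / Suc n - slope p n * \<delta>) \<in> STAB (H_verts k) (H_edges k)"
    using eventually_sym_vec_mem_LS_plus_funpow[OF n(2,3), of k] eventually_at_right_less[of 0]
    unfolding eq by eventually_elim (use n(1) in simp)
  then obtain \<delta> :: real where \<delta>: "0 < \<delta>"
    and mem: "sym_vec k {1..k} (1 / Suc n + \<delta>) (n / Suc n - slope p n * \<delta>) \<in> STAB (H_verts k) (H_edges k)"
    using eventually_happens' trivial_limit_at_right_real by blast
  have "k * ((real k - 1) * (2 * (1 / Suc n + \<delta>)) + (real k - 2) * (n / Suc n - slope p n * \<delta>))
      \<le> k * (real k - 1)"
    using STAB_H_valid[OF mem] by (simp add: sym_vec_def)
  then have "(real k - 1) * (2 * (1 / Suc n + \<delta>)) + (real k - 2) * (n / Suc n - slope p n * \<delta>) \<le> real k - 1"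
    using n by (simp add: mult_le_cancel_left)
  then have "n * (2 * (1 / (n + 1) + \<delta>)) + (real n - 1) * (n / (n + 1) - slope p n * \<delta>) \<le> real n"
    using n by (simp add: add.commute)
  moreover have "n * (2 * (1 / (n + 1) + \<delta>)) + (real n - 1) * (n / (n + 1) - slope p n * \<delta>)
      = n + \<delta> * (2 * n - (real n - 1) * slope p n)"
    by (simp add: divide_simps; simp add: algebra_simps)
  ultimately have "\<delta> * (2 * n - (real n - 1) * slope p n) \<le> 0" by simp
  (* The edge of STAB has slope - 2 n / (n - 1), which is steeper than - 2. *)
  moreover have "slope p n \<le> 2" using n by (simp add: slope_def field_simps)
  then have "(real n - 1) * slope p n \<le> (real n - 1) * 2" using n by (intro mult_left_mono) auto
  then have "0 < \<delta> * (2 * n - (real n - 1) * slope p n)" using \<delta> by (intro mult_pos_pos) auto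
  ultimately show False by simp
qed

theorem theorem2:
  fixes k :: nat
  assumes "k \<ge> 3"
  shows "real (LS_plus_rank (H_verts k) (H_edges k)) \<ge> 1 / 16 * real (card (H_verts k))"
proof (rule ccontr)
  define p where "p = LS_plus_rank (H_verts k) (H_edges k)"
  assume "\<not> ?thesis"
  then have "16 * p < 3 * k" by (simp add: p_def card_H_verts field_simps)
  then have "5 * p + 1 \<le> k" by linarith
  moreover have "(LS_plus (H_verts k) ^^ p) (FRAC (H_verts k) (H_edges k)) = STAB (H_verts k) (H_edges k)"
    unfolding p_def LS_plus_rank_def by (rule LeastI, rule LS_plus_funpow_card) simp
  ultimately show False using LS_plus_funpow_H_neq_STAB assms by blast
qed

end
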